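(* Let the ruled surfaces $\varphi_e$ and $\varphi_{e_1}$ form a Mannheim surface offset, with dual offset angle $\bar\theta=\theta+\varepsilon\theta^*$. Then the real arc-length parameters $s,s_1$ and the invariants of $\varphi_e$ and $\varphi_{e_1}$ satisfy $$\frac{ds_1}{ds}=\gamma\sin\theta,\qquad \Delta_1=\theta^*\cot\theta+\frac{\delta}{\gamma}.$$
   Context: Dual numbers: $D=\{a+\varepsilon a^*: a,a^*\in\mathbb{R}\}$ with $\varepsilon^2=0$. A differentiable real function $f$ extends to $D$ by $f(x+\varepsilon x^* )=f(x)+\varepsilon x^* f'(x)$; in particular this defines $\sin$, $\cos$. Dual vectors are $\tilde a=\vec a+\varepsilon\vec a^*$ with $\vec a,\vec a^*\in\mathbb{R}^3$; scalar and cross products are extended $D$-bilinearly. Ruled surface: all functions are smooth. $\varphi_e(s,v)=\vec c(s)+v\,\vec e(s)$, $s$ in an open interval, where $\langle\vec e,\vec e\rangle=1$, $s$ is the arc-length of the spherical curve $\vec e$, i.e. $\langle\vec e\,',\vec e\,'\rangle=1$, and $\vec c$ is the striction curve, i.e. $\langle\vec c\,',\vec e\,'\rangle=0$ (prime $=d/ds$). Put $\vec t=\vec e\,'$, $\vec g=\vec e\times\vec t$. The conical curvature $\gamma$ is defined by $\vec t\,'=\gamma\vec g-\vec e$ (so $\vec g\,'=-\gamma\vec t$). Put $\Delta=\det(\vec c\,',\vec e,\vec t)$ and $\delta=\langle\vec c\,',\vec e\rangle$. The ruled surface is represented by the dual unit vector $\tilde e=\vec e+\varepsilon\,\vec c\times\vec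 e$; its dual Darboux frame is $\{\tilde e,\tilde t,\tilde g\}$ with $\tilde t=\vec t+\varepsilon\,\vec c\times\vec t$, $\tilde g=\vec g+\varepsilon\,\vec c\times\vec g$. A second ruled surface $\varphi_{e_1}$ is given in the same way; the same symbols with index $1$ ($s_1,\vec c_1,\vec e_1,\vec t_1,\vec g_1,\gamma_1,\Delta_1,\delta_1,\tilde e_1,\tilde t_1,\tilde g_1$) denote its corresponding objects, with derivatives taken with respect to $s_1$. Mannheim surface offset: $\varphi_e$ and $\varphi_{e_1}$ are Mannheim surface offsets if there is a one-to-one correspondence $s\mapsto s_1(s)$ between their rulings (smooth, with $ds_1/ds\neq0$) such that $\tilde g=\tilde t_1$ at corresponding parameters. Then the frames are related by $\tilde e_1=\cos\bar\theta\,\tilde e+\sin\bar\theta\,\tilde t$, $\tilde t_1=\tilde g$, $\tilde g_1=\sin\bar\theta\,\tilde e-\cos\bar\theta\,\tilde t$, where $\bar\theta=\theta+\varepsilon\theta^*$ (a smooth function of $s$, with $0\le\theta\le\pi$, $\theta^*\in\mathbb{R}$) is the dual angle between $\tilde e$ and $\tilde e_1$, called the dual offset angle; $\theta$ is the offset angle and $\theta^*$ the offset distance. *)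

theory Defs
  imports "HOL-Analysis.Analysis"
begin

unbundle cross3_syntax

section \<open>Dual numbers and dual vectors\<close>

text \<open>
  \<open>Dual a b\<close> stands for \<open>a + \<epsilon> b\<close>. The dual numbers \<open>D\<close> are the type \<open>real dual\<close>, the dual
  vectors are the type \<open>(real^3) dual\<close>.
\<close>

datatype 'a dual = Dual (real_part: 'a) (dual_part: 'a)

instantiation dual :: (plus) plus
begin
definition plus_dual :: "'a dual \<Rightarrow> 'a dual \<Rightarrow> 'a dual" where
  "x + y = Dual (real_part x + real_part y) (dual_part x + dual_part y)"
instance ..
end

text \<open>
  The action of \<open>D\<close> coming from \<open>\<epsilon>\<^sup>2 = 0\<close>. On \<open>real dual\<close> it is the multiplication of \<open>D\<close>, on
  \<open>(real^3) dual\<close> the multiplication of a dual vector by a dual number.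
\<close>

definition dual_scale :: "real dual \<Rightarrow> 'a::real_vector dual \<Rightarrow> 'a dual"  (infixr \<open>*\<^sub>D\<close> 75) where
  "z *\<^sub>D x = Dual (real_part z *\<^sub>R real_part x)
                 (real_part z *\<^sub>R dual_part x + dual_part z *\<^sub>R real_part x)"

definition dual_ext :: "(real \<Rightarrow> real) \<Rightarrow> real dual \<Rightarrow> real dual" where
  "dual_ext f z = Dual (f (real_part z)) (dual_part z * deriv f (real_part z))"

section \<open>Smooth functions on an open set of parameters\<close>

definition iter_deriv :: "nat \<Rightarrow> (real \<Rightarrow> 'a::real_normed_vector) \<Rightarrow> real \<Rightarrow> 'a" where
  "iter_deriv n f = ((\<lambda>h s. vector_derivative h (at s)) ^^ n) f"

definition smooth_on :: "real set \<Rightarrow> (real \<Rightarrow> 'a::real_normed_vector) \<Rightarrow> bool" where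
  "smooth_on I f \<longleftrightarrow> (\<forall>n. \<forall>s\<in>I. iter_deriv n f differentiable (at s))"

section \<open>Ruled surfaces\<close>

text \<open>
  A ruled surface \<open>\<phi>(s,v) = c(s) + v e(s)\<close> is given by its parameter interval \<open>I\<close>, its striction
  curve \<open>c\<close> and the direction \<open>e\<close> of its rulings, with \<open>s\<close> the arc-length of \<open>e\<close>.
\<close>

definition ruled_surface :: "real set \<Rightarrow> (real \<Rightarrow> real^3) \<Rightarrow> (real \<Rightarrow> real^3) \<Rightarrow> bool" where
  "ruled_surface I c e \<longleftrightarrow>
     open I \<and> is_interval I \<and> I \<noteq> {} \<and> smooth_on I c \<and> smooth_on I e \<and>
     (\<forall>s\<in>I. e s \<bullet> e s = 1 \<and>
            vector_derivative e (at s) \<bullet> vector_derivative e (at s) = 1 \<and>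
            vector_derivative c (at s) \<bullet> vector_derivative e (at s) = 0)"

definition tvec :: "(real \<Rightarrow> real^3) \<Rightarrow> real \<Rightarrow> real^3" where
  "tvec e s = vector_derivative e (at s)"

definition gvec :: "(real \<Rightarrow> real^3) \<Rightarrow> real \<Rightarrow> real^3" where
  "gvec e s = e s \<times> tvec e s"

definition conical_curvature :: "(real \<Rightarrow> real^3) \<Rightarrow> real \<Rightarrow> real" where
  "conical_curvature e s =
     (THE k. vector_derivative (tvec e) (at s) = k *\<^sub>R gvec e s - e s)"

definition Delta_inv :: "(real \<Rightarrow> real^3) \<Rightarrow> (real \<Rightarrow> real^3) \<Rightarrow> real \<Rightarrow> real" where
  "Delta_inv c e s = det (vector [vector_derivative c (at s), e s, tvec e s] :: real^3^3)"

definition delta_inv :: "(real \<Rightarrow> real^3) \<Rightarrow> (real \<Rightarrow> real^3) \<Rightarrow> real \<Rightarrow> real" where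
  "delta_inv c e s = vector_derivative c (at s) \<bullet> e s"

definition dual_e :: "(real \<Rightarrow> real^3) \<Rightarrow> (real \<Rightarrow> real^3) \<Rightarrow> real \<Rightarrow> (real^3) dual" where
  "dual_e c e s = Dual (e s) (c s \<times> e s)"

definition dual_t :: "(real \<Rightarrow> real^3) \<Rightarrow> (real \<Rightarrow> real^3) \<Rightarrow> real \<Rightarrow> (real^3) dual" where
  "dual_t c e s = Dual (tvec e s) (c s \<times> tvec e s)"

definition dual_g :: "(real \<Rightarrow> real^3) \<Rightarrow> (real \<Rightarrow> real^3) \<Rightarrow> real \<Rightarrow> (real^3) dual" where
  "dual_g c e s = Dual (gvec e s) (c s \<times> gvec e s)"

section \<open>Mannheim surface offsets\<close>

text \<open>\<open>\<sigma>\<close> is the correspondence \<open>s \<mapsto> s\<^sub>1(s)\<close> between the rulings.\<close>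

definition mannheim_offset ::
  "real set \<Rightarrow> (real \<Rightarrow> real^3) \<Rightarrow> (real \<Rightarrow> real^3) \<Rightarrow>
   real set \<Rightarrow> (real \<Rightarrow> real^3) \<Rightarrow> (real \<Rightarrow> real^3) \<Rightarrow> (real \<Rightarrow> real) \<Rightarrow> bool" where
  "mannheim_offset I c e I\<^sub>1 c\<^sub>1 e\<^sub>1 \<sigma> \<longleftrightarrow>
     ruled_surface I c e \<and> ruled_surface I\<^sub>1 c\<^sub>1 e\<^sub>1 \<and>
     bij_betw \<sigma> I I\<^sub>1 \<and> smooth_on I \<sigma> \<and> (\<forall>s\<in>I. deriv \<sigma> s \<noteq> 0) \<and>
     (\<forall>s\<in>I. dual_g c e s = dual_t c\<^sub>1 e\<^sub>1 (\<sigma> s))"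

text \<open>
  The relation for the second frame vector is the Mannheim condition itself, and the one for the
  third, \<open>sin \<theta> e - cos \<theta> t\<close> (dual quantities), is the cross product of the first two.
  So the angle is pinned down by the relation for the first frame vector. This relation, unlike the
  mere value of \<open>cos \<theta>\<close>, also fixes the sign in front of \<open>sin \<theta>\<close>.
\<close>

definition dual_offset_angle ::
  "real set \<Rightarrow> (real \<Rightarrow> real^3) \<Rightarrow> (real \<Rightarrow> real^3) \<Rightarrow>
   (real \<Rightarrow> real^3) \<Rightarrow> (real \<Rightarrow> real^3) \<Rightarrow> (real \<Rightarrow> real) \<Rightarrow> (real \<Rightarrow> real dual) \<Rightarrow> bool" where
  "dual_offset_angle I c e c\<^sub>1 e\<^sub>1 \<sigma> \<Theta> \<longleftrightarrow>
     smooth_on I (\<lambda>s. real_part (\<Theta> s)) \<and> smooth_on I (\<lambda>s. dual_part (\<Theta> s)) \<and>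
     (\<forall>s\<in>I. 0 \<le> real_part (\<Theta> s) \<and> real_part (\<Theta> s) \<le> pi \<and>
            dual_e c\<^sub>1 e\<^sub>1 (\<sigma> s) =
              dual_ext cos (\<Theta> s) *\<^sub>D dual_e c e s + dual_ext sin (\<Theta> s) *\<^sub>D dual_t c e s)"

end

theory Submission
  imports Defs
begin

text \<open>
  The relation \<open>e\<^sub>1 = cos \<Theta> e + sin \<Theta> t\<close> between dual vectors determines both the direction
  and the position of the second surface in terms of the first. Each identity comes from
  differentiating one of the two along the correspondence \<open>\<sigma>\<close> and comparing coefficients in
  the Darboux frame \<open>e, t, g\<close> of the first surface.

  In the real part, \<open>e\<^sub>1 \<circ> \<sigma> = cos \<theta> e + sin \<theta> t\<close>. By the chain rule its derivative is
  \<open>\<sigma>' t\<^sub>1 = \<sigma>' g\<close>, since \<open>t\<^sub>1 = g\<close> by the Mannheim condition. By the frame equations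
  \<open>e' = t\<close> and \<open>t' = \<gamma> g - e\<close> (lemma \<open>darboux_frame\<close>), the \<open>g\<close>-coefficient of the derivative
  of the right-hand side is \<open>\<gamma> sin \<theta>\<close>. Hence \<open>\<sigma>' = \<gamma> sin \<theta>\<close>, and neither \<open>\<gamma>\<close> nor
  \<open>sin \<theta>\<close> vanishes, because \<open>\<sigma>'\<close> does not.

  The dual parts describe positions of lines. The second surface has its striction point on the
  line through \<open>c\<close> with direction \<open>g\<close>, and the dual part of the relation above fixes its place
  there: \<open>c\<^sub>1 \<circ> \<sigma> = c + \<theta>\<^sup>* g\<close> (lemma \<open>offset_striction_point\<close>). Differentiating,
  \<open>\<sigma>' c\<^sub>1' = c' + \<theta>\<^sup>*' g - \<theta>\<^sup>* \<gamma> t\<close>. The invariant \<open>\<Delta>\<^sub>1\<close> is the component of \<open>c\<^sub>1'\<close> along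
  \<open>g\<^sub>1 = sin \<theta> e - cos \<theta> t\<close>. As \<open>c'\<close> has the \<open>e\<close>-component \<open>\<delta>\<close> and no \<open>t\<close>-component, this
  gives \<open>\<sigma>' \<Delta>\<^sub>1 = \<delta> sin \<theta> + \<theta>\<^sup>* \<gamma> cos \<theta>\<close>, and division by \<open>\<sigma>' = \<gamma> sin \<theta>\<close> yields the
  second identity.
\<close>

section \<open>Derivatives along a parameter interval\<close>

lemma smooth_on_has_vector_derivative:
  assumes "smooth_on I f" "s \<in> I"
  shows "(f has_vector_derivative vector_derivative f (at s)) (at s)"
proof -
  have "iter_deriv 0 f differentiable (at s)"
    using assms unfolding smooth_on_def by blast
  then show ?thesis
    by (simp add: iter_deriv_def vector_derivative_works)
qed

lemma smooth_on_derivative_has_vector_derivative: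
  assumes "smooth_on I f" "s \<in> I"
  shows "((\<lambda>u. vector_derivative f (at u)) has_vector_derivative
            vector_derivative (\<lambda>u. vector_derivative f (at u)) (at s)) (at s)"
proof -
  have "iter_deriv 1 f differentiable (at s)"
    using assms unfolding smooth_on_def by blast
  then show ?thesis
    by (simp add: iter_deriv_def vector_derivative_works)
qed

lemma smooth_on_has_real_derivative:
  fixes f :: "real \<Rightarrow> real"
  assumes "smooth_on I f" "s \<in> I"
  shows "(f has_real_derivative deriv f s) (at s)"
  using smooth_on_has_vector_derivative[OF assms]
  by (metis DERIV_imp_deriv has_real_derivative_iff_has_vector_derivative)

lemma has_vector_derivative_equal_on_open:
  assumes "open I" "s \<in> I" "\<And>u. u \<in> I \<Longrightarrow> f u = h u"
    and "(f has_vector_derivative f') (at s)" "(h has_vector_derivative h') (at s)"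
  shows "f' = h'"
  using has_vector_derivative_transform_within_open[OF assms(4,1,2,3)] assms(5)
    vector_derivative_unique_at by blast

lemma inner_derivative_of_constant:
  fixes f h :: "real \<Rightarrow> 'a::real_inner"
  assumes "open I" "s \<in> I" "\<And>u. u \<in> I \<Longrightarrow> f u \<bullet> h u = k"
    and "(f has_vector_derivative f') (at s)" "(h has_vector_derivative h') (at s)"
  shows "f s \<bullet> h' + f' \<bullet> h s = 0"
proof -
  have "((\<lambda>u. f u \<bullet> h u) has_derivative (\<lambda>x. f s \<bullet> (x *\<^sub>R h') + (x *\<^sub>R f') \<bullet> h s)) (at s)"
    using assms(4,5) unfolding has_vector_derivative_def by (rule has_derivative_inner)
  then have "((\<lambda>u. f u \<bullet> h u) has_vector_derivative (f s \<bullet> h' + f' \<bullet> h s)) (at s)"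
    by (simp add: has_vector_derivative_def algebra_simps)
  then have "((\<lambda>u. k) has_vector_derivative (f s \<bullet> h' + f' \<bullet> h s)) (at s)"
    by (rule has_vector_derivative_transform_within_open) (use assms in auto)
  then show ?thesis
    using vector_derivative_unique_at has_vector_derivative_const by blast
qed

section \<open>The Darboux frame\<close>

text \<open>
  A vector \<open>y\<close> with no component along \<open>e\<close> and \<open>t\<close> has \<open>y \<times> (e \<times> t) = 0\<close> by Lagrange's
  formula, so it vanishes as soon as it is also orthogonal to the unit vector \<open>e \<times> t\<close>.
\<close>

lemma orthonormal_cross_expansion:
  fixes x e t :: "real^3"
  assumes "e \<bullet> e = 1" "t \<bullet> t = 1" "e \<bullet> t = 0"
  shows "x = (x \<bullet> e) *\<^sub>R e + (x \<bullet> t) *\<^sub>R t + (x \<bullet> (e \<times> t)) *\<^sub>R (e \<times> t)"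
proof -
  define g where "g = e \<times> t"
  have g: "g \<bullet> g = 1" "g \<bullet> e = 0" "g \<bullet> t = 0"
    using assms by (simp_all add: g_def dot_cross inner_commute dot_cross_self)
  define y where "y = x - ((x \<bullet> e) *\<^sub>R e + (x \<bullet> t) *\<^sub>R t + (x \<bullet> g) *\<^sub>R g)"
  have y: "y \<bullet> e = 0" "y \<bullet> t = 0" "y \<bullet> g = 0"
    using assms g by (simp_all add: y_def inner_diff_right inner_add_right inner_commute)
  have "y \<times> g = 0"
    using y by (simp add: g_def Lagrange inner_commute)
  then have "y = 0"
    using norm_and_cross_eq_0[of y g] y g by auto
  then show ?thesis by (simp add: y_def g_def)
qed

text \<open>
  Differentiating \<open>e \<bullet> e = 1\<close>, \<open>t \<bullet> t = 1\<close> and \<open>e \<bullet> t = 0\<close> shows that \<open>t'\<close> has the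
  \<open>e\<close>-component \<open>-1\<close> and no \<open>t\<close>-component. This is why the description defining the conical
  curvature denotes a number, namely the \<open>g\<close>-component of \<open>t'\<close>.
\<close>

lemma darboux_frame:
  assumes R: "ruled_surface I c e" and s: "s \<in> I"
  shows "e s \<bullet> e s = 1" "tvec e s \<bullet> tvec e s = 1" "e s \<bullet> tvec e s = 0"
    and "(e has_vector_derivative tvec e s) (at s)"
    and "(tvec e has_vector_derivative conical_curvature e s *\<^sub>R gvec e s - e s) (at s)"
    and "(gvec e has_vector_derivative - conical_curvature e s *\<^sub>R tvec e s) (at s)"
proof -
  have I: "open I" and unit: "\<And>u. u \<in> I \<Longrightarrow> e u \<bullet> e u = 1" "\<And>u. u \<in> I \<Longrightarrow> tvec e u \<bullet> tvec e u = 1"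
    and smooth: "smooth_on I e"
    using R by (auto simp: ruled_surface_def tvec_def)
  have e': "(e has_vector_derivative tvec e u) (at u)" if "u \<in> I" for u
    using smooth_on_has_vector_derivative[OF smooth that] by (simp add: tvec_def)
  define t' where "t' = vector_derivative (tvec e) (at s)"
  have t': "(tvec e has_vector_derivative t') (at s)"
    using smooth_on_derivative_has_vector_derivative[OF smooth s]
    by (simp add: t'_def tvec_def[abs_def])
  have orth: "e u \<bullet> tvec e u = 0" if "u \<in> I" for u
    using inner_derivative_of_constant[OF I that unit(1) e'[OF that] e'[OF that]]
    by (simp add: inner_commute)
  have te: "t' \<bullet> e s = -1"
    using inner_derivative_of_constant[OF I s orth e'[OF s] t'] unit(2)[OF s]
    by (simp add: inner_commute)
  have tt: "t' \<bullet> tvec e s = 0"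
    using inner_derivative_of_constant[OF I s unit(2) t' t'] by (simp add: inner_commute)
  have t'_eq: "t' = (t' \<bullet> gvec e s) *\<^sub>R gvec e s - e s"
    using orthonormal_cross_expansion[OF unit(1)[OF s] unit(2)[OF s] orth[OF s], of t'] te tt
    by (simp add: gvec_def)
  have "gvec e s \<bullet> gvec e s = 1" "e s \<bullet> gvec e s = 0"
    using unit[OF s] orth[OF s] by (simp_all add: gvec_def dot_cross dot_cross_self inner_commute)
  then have "conical_curvature e s = t' \<bullet> gvec e s"
    unfolding conical_curvature_def t'_def[symmetric]
    by (intro the_equality t'_eq) (simp add: inner_diff_left)
  with t'_eq have t'_curv: "t' = conical_curvature e s *\<^sub>R gvec e s - e s" by simp
  show "e s \<bullet> e s = 1" "tvec e s \<bullet> tvec e s = 1" "e s \<bullet> tvec e s = 0"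
    and "(e has_vector_derivative tvec e s) (at s)"
    and "(tvec e has_vector_derivative conical_curvature e s *\<^sub>R gvec e s - e s) (at s)"
    using unit orth e' t' t'_curv s by auto
  have "((\<lambda>u. e u \<times> tvec e u) has_vector_derivative (e s \<times> t' + tvec e s \<times> tvec e s)) (at s)"
    using bounded_bilinear.has_vector_derivative[OF bilinear_cross[THEN bilinear_conv_bounded_bilinear[THEN iffD1]] e'[OF s] t'] .
  moreover have "e s \<times> t' + tvec e s \<times> tvec e s = - conical_curvature e s *\<^sub>R tvec e s"
    using unit(1)[OF s] orth[OF s]
    by (simp add: t'_curv gvec_def Cross3.right_diff_distrib cross_mult_right Lagrange)
  ultimately show "(gvec e has_vector_derivative - conical_curvature e s *\<^sub>R tvec e s) (at s)"
    by (simp add: gvec_def[abs_def])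
qed

section \<open>Mannheim offsets\<close>

text \<open>
  Equality of the dual parts of \<open>g\<close> and \<open>t\<^sub>1\<close> puts \<open>c\<^sub>1 - c\<close> on the line spanned by \<open>g\<close>, say
  \<open>c\<^sub>1 - c = \<lambda> g\<close>. The moments of the first frame vectors then give
  \<open>\<lambda> u = \<theta>\<^sup>* u\<close> for the unit vector \<open>u = cos \<theta> t - sin \<theta> e\<close>, so \<open>\<lambda> = \<theta>\<^sup>*\<close>. Here \<open>a\<close> and \<open>b\<close>
  stand for \<open>\<theta>\<close> and \<open>\<theta>\<^sup>*\<close>.
\<close>

lemma offset_striction_point:
  fixes c c\<^sub>1 e t :: "real^3"
  assumes unit: "e \<bullet> e = 1" "t \<bullet> t = 1" and orth: "e \<bullet> t = 0"
    and moment_g: "c\<^sub>1 \<times> (e \<times> t) = c \<times> (e \<times> t)"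
    and moment_e: "c\<^sub>1 \<times> (cos a *\<^sub>R e + sin a *\<^sub>R t) =
       cos a *\<^sub>R (c \<times> e) - (b * sin a) *\<^sub>R e + sin a *\<^sub>R (c \<times> t) + (b * cos a) *\<^sub>R t"
  shows "c\<^sub>1 = c + b *\<^sub>R (e \<times> t)"
proof -
  define g where "g = e \<times> t"
  define d where "d = c\<^sub>1 - c"
  define u where "u = cos a *\<^sub>R t - sin a *\<^sub>R e"
  have "d \<times> g = 0"
    using moment_g by (simp add: d_def g_def Cross3.left_diff_distrib)
  then have "(d \<bullet> t) *\<^sub>R e = (d \<bullet> e) *\<^sub>R t"
    by (simp add: g_def Lagrange)
  then have "(d \<bullet> t) *\<^sub>R e \<bullet> e = (d \<bullet> e) *\<^sub>R t \<bullet> e" "(d \<bullet> t) *\<^sub>R e \<bullet> t = (d \<bullet> e) *\<^sub>R t \<bullet> t"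
    by simp_all
  then have "d \<bullet> t = 0" "d \<bullet> e = 0"
    using unit orth by (simp_all add: inner_commute)
  then have d: "d = (d \<bullet> g) *\<^sub>R g"
    using orthonormal_cross_expansion[OF unit orth, of d] by (simp add: g_def)
  have ge: "g \<times> e = t" and gt: "g \<times> t = - e"
    using unit orth cross_skew[of g e] cross_skew[of g t]
    by (simp_all add: g_def Lagrange inner_commute)
  have "d \<times> (cos a *\<^sub>R e + sin a *\<^sub>R t) = b *\<^sub>R u"
    using moment_e
    by (simp add: d_def u_def Cross3.left_diff_distrib cross_add_right cross_mult_right algebra_simps)
  moreover have "d \<times> (cos a *\<^sub>R e + sin a *\<^sub>R t) = (d \<bullet> g) *\<^sub>R u"
    by (subst d) (simp add: u_def cross_add_right cross_mult_right cross_mult_left ge gt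
        algebra_simps)
  ultimately have "(d \<bullet> g) *\<^sub>R u = b *\<^sub>R u" by simp
  moreover have "u \<bullet> u = 1"
    using unit orth sin_cos_squared_add2[of a]
    by (simp add: u_def inner_diff_left inner_diff_right inner_commute power2_eq_square)
  then have "u \<noteq> 0" by auto
  ultimately have "d \<bullet> g = b" by simp
  with d show ?thesis by (simp add: d_def g_def diff_eq_eq add.commute)
qed

theorem theorem3p3:
  fixes I I\<^sub>1 :: "real set"
    and c e c\<^sub>1 e\<^sub>1 :: "real \<Rightarrow> real^3"
    and \<sigma> \<theta> \<theta>\<^sub>d :: "real \<Rightarrow> real"
  assumes "mannheim_offset I c e I\<^sub>1 c\<^sub>1 e\<^sub>1 \<sigma>"
    and "dual_offset_angle I c e c\<^sub>1 e\<^sub>1 \<sigma> (\<lambda>s. Dual (\<theta> s) (\<theta>\<^sub>d s))"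
  shows "\<forall>s\<in>I. deriv \<sigma> s = conical_curvature e s * sin (\<theta> s) \<and>
               Delta_inv c\<^sub>1 e\<^sub>1 (\<sigma> s) =
                 \<theta>\<^sub>d s * cot (\<theta> s) + delta_inv c e s / conical_curvature e s"
proof
  fix s assume s: "s \<in> I"
  have R: "ruled_surface I c e" and R\<^sub>1: "ruled_surface I\<^sub>1 c\<^sub>1 e\<^sub>1"
    and \<sigma>_in: "\<And>u. u \<in> I \<Longrightarrow> \<sigma> u \<in> I\<^sub>1" and \<sigma>_smooth: "smooth_on I \<sigma>"
    and \<sigma>_nz: "deriv \<sigma> s \<noteq> 0"
    and frame_g: "\<And>u. u \<in> I \<Longrightarrow> tvec e\<^sub>1 (\<sigma> u) = gvec e u"
      "\<And>u. u \<in> I \<Longrightarrow> c\<^sub>1 (\<sigma> u) \<times> gvec e u = c u \<times> gvec e u"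
    using assms(1) s by (auto simp: mannheim_offset_def dual_g_def dual_t_def bij_betw_def)
  have I: "open I" and c_smooth: "smooth_on I c" and c\<^sub>1_smooth: "smooth_on I\<^sub>1 c\<^sub>1"
    and striction: "vector_derivative c (at s) \<bullet> tvec e s = 0"
    using R R\<^sub>1 s by (auto simp: ruled_surface_def tvec_def)
  have \<theta>_smooth: "smooth_on I \<theta>" and \<theta>\<^sub>d_smooth: "smooth_on I \<theta>\<^sub>d"
    using assms(2) by (auto simp: dual_offset_angle_def)
  have deriv_trig: "deriv cos x = - sin x" "deriv sin x = cos x" for x :: real
    by (auto intro!: DERIV_imp_deriv derivative_eq_intros)
  have frame_e: "e\<^sub>1 (\<sigma> u) = cos (\<theta> u) *\<^sub>R e u + sin (\<theta> u) *\<^sub>R tvec e u"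
    and moment_e: "c\<^sub>1 (\<sigma> u) \<times> e\<^sub>1 (\<sigma> u) =
       cos (\<theta> u) *\<^sub>R (c u \<times> e u) - (\<theta>\<^sub>d u * sin (\<theta> u)) *\<^sub>R e u +
       sin (\<theta> u) *\<^sub>R (c u \<times> tvec e u) + (\<theta>\<^sub>d u * cos (\<theta> u)) *\<^sub>R tvec e u" if "u \<in> I" for u
    using assms(2) that
    by (auto simp: dual_offset_angle_def dual_e_def dual_t_def dual_scale_def dual_ext_def
        plus_dual_def deriv_trig)
  have c\<^sub>1_eq: "c\<^sub>1 (\<sigma> u) = c u + \<theta>\<^sub>d u *\<^sub>R gvec e u" if "u \<in> I" for u
    using offset_striction_point[of "e u" "tvec e u" "c\<^sub>1 (\<sigma> u)" "c u" "\<theta> u" "\<theta>\<^sub>d u"]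
      darboux_frame(1-3)[OF R that] frame_g(2)[OF that] moment_e[OF that] frame_e[OF that]
    by (simp add: gvec_def)

  note frame = darboux_frame[OF R s]
  define \<gamma> where "\<gamma> = conical_curvature e s"
  define c' where "c' = vector_derivative c (at s)"
  define c\<^sub>1' where "c\<^sub>1' = vector_derivative c\<^sub>1 (at (\<sigma> s))"
  define g where "g = gvec e s"
  define t where "t = tvec e s"
  have g: "g = e s \<times> t" by (simp add: g_def t_def gvec_def)
  have ortho: "e s \<bullet> e s = 1" "t \<bullet> t = 1" "e s \<bullet> t = 0" "t \<bullet> e s = 0"
    using frame(1-3) by (simp_all add: t_def inner_commute)
  have orthog: "g \<bullet> g = 1" "g \<bullet> e s = 0" "g \<bullet> t = 0" "e s \<bullet> g = 0" "t \<bullet> g = 0"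
    using ortho by (simp_all add: g dot_cross dot_cross_self inner_commute)
  have \<sigma>': "(\<sigma> has_vector_derivative deriv \<sigma> s) (at s)"
    and \<theta>': "(\<theta> has_real_derivative deriv \<theta> s) (at s)"
    and \<theta>\<^sub>d': "(\<theta>\<^sub>d has_real_derivative deriv \<theta>\<^sub>d s) (at s)"
    using smooth_on_has_real_derivative \<sigma>_smooth \<theta>_smooth \<theta>\<^sub>d_smooth s
    by (auto simp: has_real_derivative_iff_has_vector_derivative[symmetric])
  have e': "(e has_vector_derivative t) (at s)"
    and t': "(tvec e has_vector_derivative \<gamma> *\<^sub>R g - e s) (at s)"
    and g': "(gvec e has_vector_derivative - \<gamma> *\<^sub>R t) (at s)"
    using frame(4-6) by (simp_all add: \<gamma>_def g_def t_def)

  have e\<^sub>1_chain: "((e\<^sub>1 \<circ> \<sigma>) has_vector_derivative deriv \<sigma> s *\<^sub>R g) (at s)"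
    using vector_diff_chain_at[OF \<sigma>' darboux_frame(4)[OF R\<^sub>1 \<sigma>_in[OF s]]] frame_g(1)[OF s]
    by (simp add: g_def)
  have e\<^sub>1_frame: "((\<lambda>u. cos (\<theta> u) *\<^sub>R e u + sin (\<theta> u) *\<^sub>R tvec e u) has_vector_derivative
      (cos (\<theta> s) *\<^sub>R t + (- sin (\<theta> s) * deriv \<theta> s) *\<^sub>R e s) +
      (sin (\<theta> s) *\<^sub>R (\<gamma> *\<^sub>R g - e s) + (cos (\<theta> s) * deriv \<theta> s) *\<^sub>R tvec e s)) (at s)"
    by (intro has_vector_derivative_add has_vector_derivative_scaleR e' t'
        DERIV_fun_cos DERIV_fun_sin \<theta>')
  have "deriv \<sigma> s *\<^sub>R g =
      (cos (\<theta> s) *\<^sub>R t + (- sin (\<theta> s) * deriv \<theta> s) *\<^sub>R e s) +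
      (sin (\<theta> s) *\<^sub>R (\<gamma> *\<^sub>R g - e s) + (cos (\<theta> s) * deriv \<theta> s) *\<^sub>R t)"
    using has_vector_derivative_equal_on_open[OF I s _ e\<^sub>1_chain e\<^sub>1_frame] frame_e
    unfolding t_def comp_def by blast
  (* The g-component; t, e and their multiples by the derivative of the angle drop out. *)
  from arg_cong[OF this, of "\<lambda>x. x \<bullet> g"] have \<sigma>'_eq: "deriv \<sigma> s = \<gamma> * sin (\<theta> s)"
    using orthog by (simp add: inner_add_left inner_diff_left)

  have c\<^sub>1_chain: "((c\<^sub>1 \<circ> \<sigma>) has_vector_derivative deriv \<sigma> s *\<^sub>R c\<^sub>1') (at s)"
    unfolding c\<^sub>1'_def
    by (rule vector_diff_chain_at[OF \<sigma>' smooth_on_has_vector_derivative[OF c\<^sub>1_smooth \<sigma>_in[OF s]]])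
  have c\<^sub>1_frame: "((\<lambda>u. c u + \<theta>\<^sub>d u *\<^sub>R gvec e u) has_vector_derivative
      c' + (\<theta>\<^sub>d s *\<^sub>R (- \<gamma> *\<^sub>R t) + deriv \<theta>\<^sub>d s *\<^sub>R gvec e s)) (at s)"
    unfolding c'_def
    by (intro has_vector_derivative_add has_vector_derivative_scaleR g' \<theta>\<^sub>d'
        smooth_on_has_vector_derivative[OF c_smooth s])
  have c\<^sub>1'_eq:
    "deriv \<sigma> s *\<^sub>R c\<^sub>1' = c' + (\<theta>\<^sub>d s *\<^sub>R (- \<gamma> *\<^sub>R t) + deriv \<theta>\<^sub>d s *\<^sub>R g)"
    using has_vector_derivative_equal_on_open[OF I s _ c\<^sub>1_chain c\<^sub>1_frame] c\<^sub>1_eq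
    unfolding g_def comp_def by blast

  have eg: "e s \<times> g = - t" and tg: "t \<times> g = e s"
    using ortho by (simp_all add: g Lagrange)
  have g\<^sub>1: "e\<^sub>1 (\<sigma> s) \<times> g = sin (\<theta> s) *\<^sub>R e s - cos (\<theta> s) *\<^sub>R t"
    using frame_e[OF s] eg tg by (simp add: cross_add_left cross_mult_left t_def)
  have \<Delta>\<^sub>1: "Delta_inv c\<^sub>1 e\<^sub>1 (\<sigma> s) = c\<^sub>1' \<bullet> (e\<^sub>1 (\<sigma> s) \<times> g)"
    by (simp add: Delta_inv_def dot_cross_det[symmetric] c\<^sub>1'_def frame_g(1)[OF s] g_def)
  have "deriv \<sigma> s * Delta_inv c\<^sub>1 e\<^sub>1 (\<sigma> s) = (deriv \<sigma> s *\<^sub>R c\<^sub>1') \<bullet> (e\<^sub>1 (\<sigma> s) \<times> g)"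
    by (simp add: \<Delta>\<^sub>1)
  also have "\<dots> = delta_inv c e s * sin (\<theta> s) + \<theta>\<^sub>d s * \<gamma> * cos (\<theta> s)"
    unfolding c\<^sub>1'_eq g\<^sub>1 using ortho orthog striction
    by (simp add: inner_add_left inner_diff_left inner_diff_right delta_inv_def c'_def t_def)
  finally have "\<gamma> * sin (\<theta> s) * Delta_inv c\<^sub>1 e\<^sub>1 (\<sigma> s) =
      delta_inv c e s * sin (\<theta> s) + \<theta>\<^sub>d s * \<gamma> * cos (\<theta> s)"
    by (simp add: \<sigma>'_eq)
  moreover have "\<gamma> \<noteq> 0" "sin (\<theta> s) \<noteq> 0"
    using \<sigma>_nz \<sigma>'_eq by auto
  ultimately have "Delta_inv c\<^sub>1 e\<^sub>1 (\<sigma> s) = \<theta>\<^sub>d s * cot (\<theta> s) + delta_inv c e s / \<gamma>"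
    by (simp add: cot_def field_simps)
  with \<sigma>'_eq show "deriv \<sigma> s = conical_curvature e s * sin (\<theta> s) \<and>
      Delta_inv c\<^sub>1 e\<^sub>1 (\<sigma> s) = \<theta>\<^sub>d s * cot (\<theta> s) + delta_inv c e s / conical_curvature e s"
    by (simp add: \<gamma>_def)
qed

end
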